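(* There exist infinitely many $\mathrm{GL}_2(\mathbb{Z})$-classes of primitive ordinary integral binary quadratic forms whose discriminant is congruent to $5\pmod 8$.
   Context: A form $aX^2+bXY+cY^2$ with $a,b,c\in\mathbb{Z}$ is primitive if $\gcd(a,b,c)=1$; its discriminant is $b^2-4ac$. $\mathrm{GL}_2(\mathbb{Z})$ acts by linear substitution, and the orbit of $F$ is $[F]_{\mathrm{GL}_2(\mathbb{Z})}$. Let $[F]_{\mathrm{val}}$ be the set of integral forms $G$ with $G(\mathbb{Z}^2)=F(\mathbb{Z}^2)$. The form $F$ is ordinary if $[F]_{\mathrm{val}}=[F]_{\mathrm{GL}_2(\mathbb{Z})}$. *)

theory Defs
  imports "HOL-Analysis.Determinants" "HOL-Number_Theory.Cong"
begin

text \<open>The form with coefficients \<open>a\<close>, \<open>b\<close>, \<open>c\<close> is \<open>a X^2 + b X Y + c Y^2\<close>.\<close>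

datatype bqf = Bqf (coeff_a: int) (coeff_b: int) (coeff_c: int)

definition bqf_eval :: "bqf \<Rightarrow> int ^ 2 \<Rightarrow> int" where
  "bqf_eval F v =
     coeff_a F * (v $ 1)\<^sup>2 + coeff_b F * (v $ 1) * (v $ 2) + coeff_c F * (v $ 2)\<^sup>2"

definition bqf_primitive :: "bqf \<Rightarrow> bool" where
  "bqf_primitive F \<longleftrightarrow> Gcd {coeff_a F, coeff_b F, coeff_c F} = 1"

definition bqf_discr :: "bqf \<Rightarrow> int" where
  "bqf_discr F = (coeff_b F)\<^sup>2 - 4 * coeff_a F * coeff_c F"

definition GL2_Z :: "(int ^ 2 ^ 2) set" where
  "GL2_Z = {M. invertible M}"

text \<open>
  The coefficients of \<open>F (p X + q Y, r X + s Y)\<close>, where \<open>M\<close> has rows \<open>(p, q)\<close> and \<open>(r, s)\<close>.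
\<close>

definition bqf_subst :: "bqf \<Rightarrow> int ^ 2 ^ 2 \<Rightarrow> bqf" where
  "bqf_subst F M =
     (let a = coeff_a F; b = coeff_b F; c = coeff_c F;
          p = M $ 1 $ 1; q = M $ 1 $ 2; r = M $ 2 $ 1; s = M $ 2 $ 2
      in Bqf (a * p\<^sup>2 + b * p * r + c * r\<^sup>2)
             (2 * a * p * q + b * (p * s + q * r) + 2 * c * r * s)
             (a * q\<^sup>2 + b * q * s + c * s\<^sup>2))"

lemma bqf_eval_subst: "bqf_eval (bqf_subst F M) v = bqf_eval F (M *v v)"
  by (simp add: bqf_eval_def bqf_subst_def matrix_vector_mult_def sum_2 Let_def
      power2_eq_square algebra_simps)

definition GL2_class :: "bqf \<Rightarrow> bqf set" where
  "GL2_class F = bqf_subst F ` GL2_Z"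

definition val_class :: "bqf \<Rightarrow> bqf set" where
  "val_class F = {G. range (bqf_eval G) = range (bqf_eval F)}"

definition ordinary :: "bqf \<Rightarrow> bool" where
  "ordinary F \<longleftrightarrow> val_class F = GL2_class F"

end

theory Submission
  imports Defs "HOL-Computational_Algebra.Nth_Powers"
begin

text \<open>
  Let \<open>c > 0\<close> be a nonsquare with \<open>c \<equiv> 1 (mod 4)\<close>.  A form with the same values as
  \<open>X^2 + X Y + c Y^2\<close> represents 1, hence is equivalent to some \<open>X^2 + b X Y + d Y^2\<close> with
  \<open>b \<in> {0, 1}\<close>.  Completing the square shows that all nonsquare values of such a form are at least
  \<open>d\<close>; so if \<open>d\<close> is a nonsquare, it is the least nonsquare value, and \<open>d = c\<close>.  Moreover,
  \<open>X^2 + X Y + c Y^2\<close> never takes values \<open>\<equiv> 2 (mod 4)\<close>, but takes the value \<open>c + 2 \<equiv> 3 (mod 4)\<close>.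

  If \<open>b = 0\<close>, then \<open>d\<close> is a nonsquare, because \<open>c + 2\<close> is not a sum of two squares; but then
  the form takes the value \<open>d + 1 = c + 1 \<equiv> 2 (mod 4)\<close>.  If \<open>b = 1\<close> and \<open>d\<close> were a square, then
  \<open>d \<equiv> 1 (mod 4)\<close>, because \<open>d + 2\<close> is a value; so \<open>d + 2\<close> would be a nonsquare value and
  \<open>d \<le> c \<le> d + 2\<close>, hence \<open>c = d\<close>, contradicting that \<open>c\<close> is a nonsquare.

  So \<open>X^2 + X Y + c Y^2\<close> is ordinary, its discriminant \<open>1 - 4 c\<close> is \<open>\<equiv> 5 (mod 8)\<close>, and its values
  determine \<open>c\<close>.  Every \<open>c \<equiv> 5 (mod 8)\<close> is a nonsquare, since odd squares are \<open>\<equiv> 1 (mod 8)\<close>.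
\<close>

section \<open>Equivalence of forms\<close>

lemma bqf_subst_mult: "bqf_subst (bqf_subst F A) B = bqf_subst F (A ** B)"
  by (simp add: bqf_subst_def matrix_matrix_mult_def sum_2 Let_def power2_eq_square algebra_simps)

lemma bqf_subst_mat_1: "bqf_subst F (mat 1) = F"
  by (cases F) (simp add: bqf_subst_def mat_def Let_def)

lemma GL2_class_refl: "F \<in> GL2_class F"
proof -
  have "mat 1 \<in> GL2_Z"
    by (auto simp: GL2_Z_def invertible_def)
  then show ?thesis
    unfolding GL2_class_def by (metis bqf_subst_mat_1 image_eqI)
qed

lemma GL2_class_sym:
  assumes "G \<in> GL2_class F"
  shows "F \<in> GL2_class G"
proof -
  obtain M where "M \<in> GL2_Z" and G: "G = bqf_subst F M"
    using assms by (auto simp: GL2_class_def)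
  then obtain N where N: "M ** N = mat 1" "N ** M = mat 1"
    by (auto simp: GL2_Z_def invertible_def)
  then have "N \<in> GL2_Z"
    by (auto simp: GL2_Z_def invertible_def)
  moreover have "F = bqf_subst G N"
    by (simp add: G bqf_subst_mult N bqf_subst_mat_1)
  ultimately show ?thesis
    unfolding GL2_class_def by blast
qed

lemma GL2_class_trans:
  assumes "G \<in> GL2_class F" and "H \<in> GL2_class G"
  shows "H \<in> GL2_class F"
proof -
  obtain M N where "M \<in> GL2_Z" "G = bqf_subst F M" and "N \<in> GL2_Z" "H = bqf_subst G N"
    using assms by (auto simp: GL2_class_def)
  then show ?thesis
    by (auto simp: GL2_class_def GL2_Z_def bqf_subst_mult invertible_mult)
qed

lemma invertible_2_of_det_dvd_1:
  fixes M :: "'a::comm_ring_1 ^ 2 ^ 2"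
  assumes "det M dvd 1"
  shows "invertible M"
proof -
  obtain u where u: "det M * u = 1"
    using assms by (auto elim: dvdE)
  define N :: "'a ^ 2 ^ 2" where
    "N = vector [vector [u * M $ 2 $ 2, - u * M $ 1 $ 2], vector [- u * M $ 2 $ 1, u * M $ 1 $ 1]]"
  have "M ** N = mat 1" "N ** M = mat 1"
    using u by (simp_all add: N_def det_2 matrix_matrix_mult_def mat_def vec_eq_iff forall_2 sum_2
        algebra_simps)
  then show ?thesis
    by (auto simp: invertible_def)
qed

lemma primitive_value_leading_coeff:
  assumes "coprime p r"
  obtains b c where "Bqf (bqf_eval F (vector [p, r])) b c \<in> GL2_class F"
proof -
  obtain s q where sq: "s * p + q * r = 1"
    using bezout_int[of p r] assms by auto
  define M :: "int ^ 2 ^ 2" where "M = vector [vector [p, - q], vector [r, s]]"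
  have "det M = 1"
    using sq by (simp add: M_def det_2 algebra_simps)
  then have "bqf_subst F M \<in> GL2_class F"
    by (auto simp: GL2_class_def GL2_Z_def intro!: invertible_2_of_det_dvd_1)
  moreover have "coeff_a (bqf_subst F M) = bqf_eval F (vector [p, r])"
    by (simp add: M_def bqf_subst_def bqf_eval_def Let_def)
  ultimately show thesis
    using that by (metis bqf.collapse)
qed

lemma GL2_class_translate: "Bqf a (b + 2 * a * k) (a * k\<^sup>2 + b * k + c) \<in> GL2_class (Bqf a b c)"
proof -
  define M :: "int ^ 2 ^ 2" where "M = vector [vector [1, k], vector [0, 1]]"
  have "M \<in> GL2_Z"
    by (auto simp: GL2_Z_def M_def det_2 intro!: invertible_2_of_det_dvd_1)
  moreover have "Bqf a (b + 2 * a * k) (a * k\<^sup>2 + b * k + c) = bqf_subst (Bqf a b c) M"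
    by (simp add: M_def bqf_subst_def)
  ultimately show ?thesis
    unfolding GL2_class_def by blast
qed

lemma primitive_value_normal_form:
  assumes "coprime p r" and "bqf_eval F (vector [p, r]) = n" and "n > 0"
  obtains b c where "Bqf n b c \<in> GL2_class F" "b \<in> {0..<2 * n}"
proof -
  obtain b c where F: "Bqf n b c \<in> GL2_class F"
    using primitive_value_leading_coeff assms by metis
  define k where "k = - (b div (2 * n))"
  have "b + 2 * n * k = b mod (2 * n)"
    by (simp add: k_def minus_mult_div_eq_mod)
  then have "Bqf n (b mod (2 * n)) (n * k\<^sup>2 + b * k + c) \<in> GL2_class F"
    using GL2_class_trans[OF F GL2_class_translate[of n b k c]] by simp
  moreover have "b mod (2 * n) \<in> {0..<2 * n}"
    using \<open>n > 0\<close> by simp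
  ultimately show thesis
    by (rule that)
qed

section \<open>Values of forms\<close>

abbreviation bqf_values :: "bqf \<Rightarrow> int set" where
  "bqf_values F \<equiv> range (bqf_eval F)"

lemma bqf_eval_Bqf_vector: "bqf_eval (Bqf a b c) (vector [x, y]) = a * x\<^sup>2 + b * x * y + c * y\<^sup>2"
  by (simp add: bqf_eval_def)

lemma mem_bqf_values_iff: "n \<in> bqf_values F \<longleftrightarrow> (\<exists>x y. n = bqf_eval F (vector [x, y]))"
proof -
  have "v = vector [v $ 1, v $ 2]" for v :: "int ^ 2"
    by (simp add: vec_eq_iff forall_2)
  then show ?thesis
    by (metis rangeE rangeI)
qed

lemma bqf_values_GL2_class:
  assumes "G \<in> GL2_class F"
  shows "bqf_values G = bqf_values F"
proof -
  have "bqf_values G \<subseteq> bqf_values F" if "G \<in> GL2_class F" for F G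
    using that by (auto simp: GL2_class_def bqf_eval_subst)
  then show ?thesis
    using assms GL2_class_sym by blast
qed

lemma bqf_values_eq_of_GL2_class_eq: "GL2_class F = GL2_class G \<Longrightarrow> bqf_values F = bqf_values G"
  using GL2_class_refl bqf_values_GL2_class by blast

lemma represents_1_normal_form:
  assumes "1 \<in> bqf_values F"
  obtains b c where "Bqf 1 b c \<in> GL2_class F" "b \<in> {0, 1}"
proof -
  obtain p r where pr: "bqf_eval F (vector [p, r]) = 1"
    using assms by (metis mem_bqf_values_iff)
  have "gcd p r dvd bqf_eval F (vector [p, r])"
    by (simp add: bqf_eval_def power2_eq_square)
  then have "coprime p r"
    by (simp add: pr coprime_iff_gcd_eq_1)
  then obtain b c where "Bqf 1 b c \<in> GL2_class F" "b \<in> {0..<2 * 1}"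
    by (rule primitive_value_normal_form[OF _ pr]) auto
  then show thesis
    by (intro that) auto
qed

lemma complete_the_square:
  "4 * coeff_a F * bqf_eval F v =
     (2 * coeff_a F * v $ 1 + coeff_b F * v $ 2)\<^sup>2 - bqf_discr F * (v $ 2)\<^sup>2"
  by (simp add: bqf_eval_def bqf_discr_def power2_eq_square algebra_simps)

lemma neg_discr_le_nonsquare_value:
  assumes "coeff_a F = 1" "bqf_discr F \<le> 0" and "n \<in> bqf_values F" "\<not> is_square n"
  shows "- bqf_discr F \<le> 4 * n"
proof -
  obtain v where v: "n = bqf_eval F v"
    using assms(3) by blast
  have "v $ 2 \<noteq> 0"
    using assms(1,4) by (auto simp: v bqf_eval_def)
  then have "1 \<le> (v $ 2)\<^sup>2"
    by (simp add: int_one_le_iff_zero_less)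
  then have "- bqf_discr F * 1 \<le> - bqf_discr F * (v $ 2)\<^sup>2"
    using assms(2) by (intro mult_left_mono) auto
  also have "\<dots> \<le> 4 * n"
    using complete_the_square[of F v] assms(1) v by simp
  finally show ?thesis
    by simp
qed

lemma coeff_c_le_nonsquare_value:
  assumes "b \<in> {0, 1}" "c > 0" and "n \<in> bqf_values (Bqf 1 b c)" "\<not> is_square n"
  shows "c \<le> n"
proof -
  have "bqf_discr (Bqf 1 b c) = b - 4 * c"
    using assms(1) by (auto simp: bqf_discr_def)
  then have "4 * c - b \<le> 4 * n"
    using neg_discr_le_nonsquare_value[of "Bqf 1 b c" n] assms by auto
  then show ?thesis
    using assms(1) by auto
qed

lemma coeff_c_mem_bqf_values: "c \<in> bqf_values (Bqf a b c)"
  unfolding mem_bqf_values_iff bqf_eval_Bqf_vector by (intro exI[of _ 0] exI[of _ 1]) simp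

lemma sum_coeffs_mem_bqf_values: "a + b + c \<in> bqf_values (Bqf a b c)"
  unfolding mem_bqf_values_iff bqf_eval_Bqf_vector by (intro exI[of _ 1]) simp

lemma coeff_c_determined_by_values:
  assumes "b \<in> {0, 1}" "b' \<in> {0, 1}" "c > 0" "\<not> is_square c" "\<not> is_square d"
    and values_eq: "bqf_values (Bqf 1 b d) = bqf_values (Bqf 1 b' c)"
  shows "d = c"
proof -
  have "c \<le> d"
    using coeff_c_le_nonsquare_value[of b' c d] coeff_c_mem_bqf_values[of d 1 b] assms
    by simp
  then have "d \<le> c"
    using coeff_c_le_nonsquare_value[of b d c] coeff_c_mem_bqf_values[of c 1 b'] assms
    by simp
  then show ?thesis
    using \<open>c \<le> d\<close> by simp
qed

section \<open>Congruences\<close>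

lemma square_mod_4: "(x::int)\<^sup>2 mod 4 = x mod 2"
proof (cases "even x")
  case True
  then show ?thesis
    by (auto elim!: evenE simp: power_mult_distrib)
next
  case False
  then obtain k where x: "x = 2 * k + 1"
    by (elim oddE)
  then have "x\<^sup>2 = 4 * (k\<^sup>2 + k) + 1"
    by (simp add: power2_eq_square algebra_simps)
  then have "x\<^sup>2 mod 4 = 1"
    by (simp only: mod_mult_self4) simp
  then show ?thesis
    by (simp add: x)
qed

lemma sum_two_squares_mod_4: "((x::int)\<^sup>2 + y\<^sup>2) mod 4 \<noteq> 3"
  using square_mod_4[of x] square_mod_4[of y] by presburger

lemma is_square_mod_4:
  assumes "is_square (n::int)"
  shows "n mod 4 \<in> {0, 1}"
proof -
  obtain m where "n = m\<^sup>2"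
    using assms by (elim is_nth_powerE)
  then show ?thesis
    using square_mod_4[of m] by auto
qed

lemma odd_is_square_mod_8:
  assumes "odd n" "is_square (n::int)"
  shows "n mod 8 = 1"
proof -
  obtain m where m: "n = m\<^sup>2"
    using assms(2) by (elim is_nth_powerE)
  with \<open>odd n\<close> have "odd m"
    by simp
  then obtain k where "m = 2 * k + 1"
    by (elim oddE)
  then have "n = 4 * (k * (k + 1)) + 1"
    by (simp add: m power2_eq_square algebra_simps)
  moreover have "even (k * (k + 1))"
    by simp
  then obtain j where "k * (k + 1) = 2 * j"
    by (elim evenE)
  ultimately show ?thesis
    by simp
qed

lemma odd_coeffs_value_mod_4:
  assumes "odd a" "odd b" "odd c" and "n \<in> bqf_values (Bqf a b c)"
  shows "n mod 4 \<noteq> 2"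
proof -
  obtain x y where n: "n = a * x\<^sup>2 + b * x * y + c * y\<^sup>2"
    using assms(4) by (auto simp: mem_bqf_values_iff bqf_eval_Bqf_vector)
  show ?thesis
  proof (cases "even x \<and> even y")
    case True
    then obtain u v where "x = 2 * u" "y = 2 * v"
      by (auto elim!: evenE)
    then have "n = 4 * (a * u\<^sup>2 + b * u * v + c * v\<^sup>2)"
      by (simp add: n power2_eq_square algebra_simps)
    then show ?thesis
      by simp
  next
    case False
    then have "odd n"
      using assms(1-3) by (auto simp: n)
    then show ?thesis
      by presburger
  qed
qed

section \<open>Forms with the values of a principal form\<close>

lemma diagonal_form_values_neq:
  assumes "c > 0" "c mod 4 = 1" "\<not> is_square c"
  shows "bqf_values (Bqf 1 0 d) \<noteq> bqf_values (Bqf 1 1 c)"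
proof
  assume values_eq: "bqf_values (Bqf 1 0 d) = bqf_values (Bqf 1 1 c)"
  show False
  proof (cases "is_square d")
    case True
    then obtain m where m: "d = m\<^sup>2"
      by (elim is_nth_powerE)
    have "c + 2 \<in> bqf_values (Bqf 1 0 d)"
      using values_eq sum_coeffs_mem_bqf_values[of 1 1 c] by (simp add: add.commute)
    then obtain x y where "c + 2 = x\<^sup>2 + (m * y)\<^sup>2"
      by (auto simp: m mem_bqf_values_iff bqf_eval_Bqf_vector power_mult_distrib)
    then have "(c + 2) mod 4 \<noteq> 3"
      using sum_two_squares_mod_4 by metis
    then show False
      using \<open>c mod 4 = 1\<close> by presburger
  next
    case False
    then have "d = c"
      using coeff_c_determined_by_values[of 0 1 c d] assms(1,3) values_eq by simp
    then have "c + 1 \<in> bqf_values (Bqf 1 1 c)"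
      using values_eq sum_coeffs_mem_bqf_values[of 1 0 d] by (simp add: add.commute)
    moreover have "odd c" "(c + 1) mod 4 = 2"
      using \<open>c mod 4 = 1\<close> by presburger+
    ultimately show False
      using odd_coeffs_value_mod_4[of 1 1 c "c + 1"] by simp
  qed
qed

lemma square_coeff_principal_form_values_neq:
  assumes "c > 0" "c mod 4 = 1" "\<not> is_square c" and "is_square d"
  shows "bqf_values (Bqf 1 1 d) \<noteq> bqf_values (Bqf 1 1 c)"
proof
  assume values_eq: "bqf_values (Bqf 1 1 d) = bqf_values (Bqf 1 1 c)"
  have "d + 2 \<in> bqf_values (Bqf 1 1 d)"
    using sum_coeffs_mem_bqf_values[of 1 1 d] by (simp add: add.commute)
  then have d2_value: "d + 2 \<in> bqf_values (Bqf 1 1 c)"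
    using values_eq by simp
  have "odd c"
    using \<open>c mod 4 = 1\<close> by presburger
  then have "(d + 2) mod 4 \<noteq> 2"
    using odd_coeffs_value_mod_4[of 1 1 c] d2_value by simp
  moreover have "d mod 4 = 0 \<or> d mod 4 = 1"
    using is_square_mod_4[OF \<open>is_square d\<close>] by simp
  ultimately have d_mod_4: "d mod 4 = 1" "(d + 2) mod 4 = 3"
    by presburger+
  have "d \<ge> 0"
    using \<open>is_square d\<close> by (auto elim: is_nth_powerE)
  with d_mod_4(1) have "d > 0"
    by presburger
  then have "d \<le> c"
    using coeff_c_le_nonsquare_value[of 1 d c] coeff_c_mem_bqf_values[of c 1 1] values_eq
      \<open>\<not> is_square c\<close> by simp
  moreover have "\<not> is_square (d + 2)"
    using is_square_mod_4[of "d + 2"] d_mod_4(2) by auto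
  then have "c \<le> d + 2"
    using coeff_c_le_nonsquare_value[of 1 c "d + 2"] d2_value \<open>c > 0\<close> by simp
  ultimately have "c = d"
    using \<open>c mod 4 = 1\<close> d_mod_4(1) by presburger
  then show False
    using \<open>is_square d\<close> \<open>\<not> is_square c\<close> by simp
qed

lemma principal_form_values_eq_iff:
  assumes "c > 0" "c mod 4 = 1" "\<not> is_square c"
  shows "bqf_values (Bqf 1 1 d) = bqf_values (Bqf 1 1 c) \<longleftrightarrow> d = c"
proof
  assume values_eq: "bqf_values (Bqf 1 1 d) = bqf_values (Bqf 1 1 c)"
  then have "\<not> is_square d"
    using square_coeff_principal_form_values_neq[OF assms] by blast
  then show "d = c"
    using coeff_c_determined_by_values[of 1 1 c d] assms(1,3) values_eq by simp
qed simp

lemma ordinary_principal_form: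
  assumes "c > 0" "c mod 4 = 1" "\<not> is_square c"
  shows "ordinary (Bqf 1 1 c)"
proof -
  have "G \<in> GL2_class (Bqf 1 1 c)" if G: "bqf_values G = bqf_values (Bqf 1 1 c)" for G
  proof -
    have "1 = bqf_eval (Bqf 1 1 c) (vector [1, 0])"
      by (simp add: bqf_eval_Bqf_vector)
    then have "1 \<in> bqf_values G"
      unfolding G by (rule range_eqI)
    then obtain b d where normal: "Bqf 1 b d \<in> GL2_class G" and b: "b \<in> {0, 1}"
      by (rule represents_1_normal_form)
    have "bqf_values (Bqf 1 b d) = bqf_values (Bqf 1 1 c)"
      using bqf_values_GL2_class[OF normal] G by simp
    then have "b = 1" "d = c"
      using b diagonal_form_values_neq[OF assms] principal_form_values_eq_iff[OF assms] by auto
    then show ?thesis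
      using GL2_class_sym[OF normal] by simp
  qed
  then show ?thesis
    unfolding ordinary_def val_class_def using bqf_values_GL2_class by blast
qed

theorem theorem1p14:
  "infinite {GL2_class F | F. bqf_primitive F \<and> ordinary F \<and> [bqf_discr F = 5] (mod 8)}"
proof -
  define c :: "nat \<Rightarrow> int" where "c n = 8 * int n + 5" for n
  define F where "F n = Bqf 1 1 (c n)" for n
  have c_conds: "c n > 0" "c n mod 4 = 1" "\<not> is_square (c n)" for n
    using odd_is_square_mod_8[of "c n"] by (auto simp: c_def) presburger
  have "inj (\<lambda>n. GL2_class (F n))"
  proof (rule injI)
    fix i j
    assume "GL2_class (F i) = GL2_class (F j)"
    then have "bqf_values (Bqf 1 1 (c i)) = bqf_values (Bqf 1 1 (c j))"
      unfolding F_def by (rule bqf_values_eq_of_GL2_class_eq)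
    then have "c i = c j"
      by (rule principal_form_values_eq_iff[OF c_conds, THEN iffD1])
    then show "i = j"
      by (simp add: c_def)
  qed
  then have "infinite (range (\<lambda>n. GL2_class (F n)))"
    by (rule range_inj_infinite)
  moreover have "bqf_primitive (F n)" "ordinary (F n)" "[bqf_discr (F n) = 5] (mod 8)" for n
    using ordinary_principal_form[OF c_conds]
    by (simp_all add: F_def c_def bqf_primitive_def bqf_discr_def cong_iff_dvd_diff)
  ultimately show ?thesis
    by (elim infinite_super[rotated]) blast
qed

end
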